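(* Let $l\ge 1$ be an integer and let $G$ be a simple connected graph with $|E(G)|-|V(G)|=l-1$. Then a random $n$-lift of $G$ is connected with probability $1-\frac{1}{n^{l-1}}+O\left(\frac{1}{n^{l}}\right)$ as $n\to\infty$.
   Context: A random $n$-lift $\tilde G$ of a graph $G$ is constructed as follows: orient the edges of $G$ arbitrarily and assign to each edge $e$ a permutation $\pi_e\in\mathcal{S}_n$, independently and uniformly at random. The vertex set of $\tilde G$ is $V(G)\times\{1,\dots,n\}$, and $(u,i)$ is joined to $(v,j)$ (by an unoriented edge) if and only if there is an edge $e$ of $G$ oriented from $u$ to $v$ with $\pi_e(i)=j$. *)

theory Defs
  imports
    "HOL-Probability.Probability"
    "HOL-Library.Landau_Symbols"
    "HOL-Combinatorics.Permutations"
    "Graph_Theory.Digraph_Component"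
begin

text \<open>
  A finite simple graph is a \<^locale>\<open>pair_graph\<close> of the Graph Theory library: a finite, loop-free, symmetric
  relation, in which an undirected edge \<open>{u, v}\<close> is present as the two arcs \<open>(u, v)\<close> and \<open>(v, u)\<close>.
\<close>

definition uedges :: "'a pair_pre_digraph \<Rightarrow> 'a set set" where
  "uedges G = (\<lambda>(u, v). {u, v}) ` parcs G"

text \<open>An orientation selects exactly one of the two arcs of every edge.\<close>

definition orientation :: "'a pair_pre_digraph \<Rightarrow> 'a rel \<Rightarrow> bool" where
  "orientation G A \<longleftrightarrow>
     A \<subseteq> parcs G \<and> (\<forall>(u, v) \<in> parcs G. (u, v) \<in> A \<longleftrightarrow> (v, u) \<notin> A)"

definition lift_graph ::
  "'a pair_pre_digraph \<Rightarrow> 'a rel \<Rightarrow> nat \<Rightarrow> ('a \<times> 'a \<Rightarrow> nat \<Rightarrow> nat) \<Rightarrow> ('a \<times> nat) pair_pre_digraph"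
where
  "lift_graph G A n \<pi> =
     (let L = {((u, i), (v, j)) | u i v j. (u, v) \<in> A \<and> i \<in> {1..n} \<and> j \<in> {1..n} \<and> \<pi> (u, v) i = j}
      in \<lparr> pverts = pverts G \<times> {1..n}, parcs = L \<union> L\<inverse> \<rparr>)"

text \<open>
  \<open>Pi_pmf\<close> makes the permutations of the arcs in \<open>A\<close> independent; its default value \<open>id\<close> is only
  used outside \<open>A\<close>.
\<close>

definition random_lift ::
  "'a pair_pre_digraph \<Rightarrow> 'a rel \<Rightarrow> nat \<Rightarrow> ('a \<times> nat) pair_pre_digraph pmf"
where
  "random_lift G A n =
     map_pmf (lift_graph G A n) (Pi_pmf A id (\<lambda>_. pmf_of_set {p. p permutes {1..n}}))"

text \<open>The name \<open>connected\<close> is shared with the topological notion of HOL-Analysis.\<close>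

abbreviation graph_connected :: "'a pair_pre_digraph \<Rightarrow> bool" where
  "graph_connected G \<equiv> Digraph_Component.connected (with_proj G)"

lemma pair_graph_lift_graph:
  assumes "pair_graph G" "orientation G A"
  shows "pair_graph (lift_graph G A n \<pi>)"
proof -
  interpret pair_graph G by fact
  have A: "A \<subseteq> parcs G" using assms(2) by (simp add: orientation_def)
  have sub: "parcs (lift_graph G A n \<pi>) \<subseteq> (pverts G \<times> {1..n}) \<times> (pverts G \<times> {1..n})"
    using A by (auto simp: lift_graph_def Let_def dest: in_arcsD1 in_arcsD2)
  have pv: "pverts (lift_graph G A n \<pi>) = pverts G \<times> {1..n}"
    by (simp add: lift_graph_def Let_def)
  have fin: "finite (pverts G \<times> {1..n})" by simp
  show ?thesis
  proof unfold_locales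
    fix e assume e: "e \<in> parcs (lift_graph G A n \<pi>)"
    show "fst e \<in> pverts (lift_graph G A n \<pi>)" "snd e \<in> pverts (lift_graph G A n \<pi>)"
      unfolding pv using subsetD[OF sub e] by (auto simp only: mem_Times_iff)
    show "fst e \<noteq> snd e"
      using e A pair_no_loops by (fastforce simp: lift_graph_def Let_def)
  next
    show "finite (pverts (lift_graph G A n \<pi>))"
      unfolding pv by (rule fin)
    show "finite (parcs (lift_graph G A n \<pi>))"
      by (rule finite_subset[OF sub finite_cartesian_product[OF fin fin]])
    show "symmetric (with_proj (lift_graph G A n \<pi>))"
      by (auto simp: symmetric_def sym_def lift_graph_def Let_def)
  qed
qed

end

theory Submission
  imports Defs "HOL-Combinatorics.Orbits" "HOL-Combinatorics.Multiset_Permutations"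
begin

text \<open>
  A union of components of the lift meets all fibres in sets \<open>S v\<close> of a common size \<open>k\<close>, because \<open>G\<close> is
  connected and the edges act by bijections. There are \<open>(n choose k)^|V|\<close> families \<open>S\<close> of \<open>k\<close>-sets, and
  each is closed with probability \<open>(n choose k)^(-|E|)\<close>, so the expected number \<open>E N\<^sub>k\<close> of closed families is
  \<open>(n choose k)^(-(l - 1))\<close>. For \<open>l \<ge> 2\<close> the probability of disconnection is at most the sum of
  \<open>E N\<^sub>k\<close> over \<open>1 \<le> k \<le> n/2\<close>, and at least \<open>E N\<^sub>1 - E N\<^sub>2\<close> since \<open>N\<^sub>1 \<le> N\<^sub>2 + 1\<close>; the terms with \<open>k \<ge> 2\<close>
  contribute \<open>O(n^(-l))\<close>. For \<open>l = 1\<close> these expectations do not decay. There a spanning tree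
  trivialises the lift, and the lift is connected only if the permutation on the one remaining edge,
  transported to a single fibre, is an \<open>n\<close>-cycle, which has probability at most \<open>1/n\<close>.
\<close>

section \<open>Connectivity as the absence of proper closed vertex sets\<close>

text \<open>The vertices reachable from a given one form a closed set, and a closed set contains
  everything that its members reach. This form lets connectivity of a lift be tested on unions of
  components.\<close>

lemma graph_connected_iff_no_closed_set:
  assumes "pair_graph H"
  shows "graph_connected H \<longleftrightarrow> pverts H \<noteq> {} \<and>
    (\<forall>X. X \<subseteq> pverts H \<longrightarrow> X \<noteq> {} \<longrightarrow> (\<forall>(x, y) \<in> parcs H. x \<in> X \<longrightarrow> y \<in> X) \<longrightarrow> X = pverts H)"
    (is "_ \<longleftrightarrow> _ \<and> ?closed")
proof -
  interpret pair_graph H by fact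
  have sym: "(y, x) \<in> parcs H" if "(x, y) \<in> parcs H" for x y
    using that pair_sym_arcs by (auto simp: symmetric_def dest: symD)
  \<comment> \<open>Connectivity means reachability in the symmetric closure, and a
    \<open>pair_graph\<close> is already symmetric.\<close>
  have arcs: "parcs (mk_symmetric (with_proj H)) = parcs H"
    by (auto simp: parcs_mk_symmetric sym)
  let ?R = "rtrancl_on (pverts H) (parcs H)"
  have conn: "graph_connected H \<longleftrightarrow> pverts H \<noteq> {} \<and> (\<forall>u\<in>pverts H. \<forall>v\<in>pverts H. (u, v) \<in> ?R)"
    by (simp add: connected_def strongly_connected_def reachable_def arcs)
  have "?closed" if *: "\<forall>u\<in>pverts H. \<forall>v\<in>pverts H. (u, v) \<in> ?R"
  proof (intro allI impI)
    fix X assume X: "X \<subseteq> pverts H" "X \<noteq> {}" "\<forall>(x, y) \<in> parcs H. x \<in> X \<longrightarrow> y \<in> X"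
    obtain u where u: "u \<in> X" using X(2) by auto
    have "v \<in> X" if "v \<in> pverts H" for v
    proof -
      have "(u, v) \<in> ?R" using * u X(1) that by auto
      then show ?thesis by (induction rule: rtrancl_on_induct) (use u X(3) in auto)
    qed
    then show "X = pverts H" using X(1) by auto
  qed
  moreover have "(u, v) \<in> ?R" if *: "?closed" and uv: "u \<in> pverts H" "v \<in> pverts H" for u v
  proof -
    let ?X = "{v. (u, v) \<in> ?R}"
    have "?X \<subseteq> pverts H" by (auto dest: in_rtrancl_on_in_F)
    moreover have "u \<in> ?X" using uv by auto
    moreover have "\<forall>(x, y) \<in> parcs H. x \<in> ?X \<longrightarrow> y \<in> ?X"
      by (auto intro: rtrancl_on_into_rtrancl_on in_arcsD2)
    ultimately have "?X = pverts H" using * by blast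
    then show ?thesis using uv by auto
  qed
  ultimately have "(\<forall>u\<in>pverts H. \<forall>v\<in>pverts H. (u, v) \<in> ?R) \<longleftrightarrow> ?closed" by (intro iffI ballI)
  then show ?thesis unfolding conn by (rule arg_cong)
qed

text \<open>Passing from an arc to its edge is injective on \<open>A\<close>, because
  \<open>A\<close> omits the reversed arc, and it reaches every edge. So the number of independent
  permutations is the number of edges.\<close>

lemma card_orientation:
  assumes "pair_graph G" "orientation G A"
  shows "card A = card (uedges G)"
proof -
  interpret pair_graph G by fact
  have A: "A \<subseteq> parcs G" "\<And>u v. (u, v) \<in> parcs G \<Longrightarrow> (u, v) \<in> A \<longleftrightarrow> (v, u) \<notin> A"
    using assms(2) by (auto simp: orientation_def)
  have "inj_on (\<lambda>(u, v). {u, v}) A"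
  proof (rule inj_onI, clarify)
    fix u v u' v' assume *: "(u, v) \<in> A" "(u', v') \<in> A" "{u, v} = {u', v'}"
    then have "(v, u) \<notin> A" using A by blast
    then show "u = u' \<and> v = v'" using * by (auto simp: doubleton_eq_iff)
  qed
  moreover have "(\<lambda>(u, v). {u, v}) ` A = uedges G"
  proof
    show "(\<lambda>(u, v). {u, v}) ` A \<subseteq> uedges G" using A(1) by (auto simp: uedges_def)
    show "uedges G \<subseteq> (\<lambda>(u, v). {u, v}) ` A"
    proof
      fix X assume "X \<in> uedges G"
      then obtain u v where uv: "(u, v) \<in> parcs G" "X = {u, v}" by (auto simp: uedges_def)
      then have "(u, v) \<in> A \<or> (v, u) \<in> A" using A(2) by blast
      then show "X \<in> (\<lambda>(u, v). {u, v}) ` A" using uv(2) by (auto intro: rev_image_eqI)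
    qed
  qed
  ultimately show ?thesis by (metis card_image)
qed

section \<open>Images of sets under uniform random permutations\<close>

text \<open>The complements of \<open>X\<close> and \<open>Y\<close> in \<open>S\<close> are
  equinumerous too, so a bijection between the sets and one between the complements glue to a
  permutation.\<close>

lemma ex_permutes_image:
  assumes "finite S" "X \<subseteq> S" "Y \<subseteq> S" "card X = card Y"
  shows "\<exists>p. p permutes S \<and> p ` X = Y"
proof -
  have fin: "finite X" "finite Y" using assms finite_subset by auto
  obtain f where f: "bij_betw f X Y" using assms fin finite_same_card_bij by blast
  have "card (S - X) = card (S - Y)" using assms fin by (simp add: card_Diff_subset)
  then obtain g where g: "bij_betw g (S - X) (S - Y)"
    using assms(1) finite_same_card_bij by (metis finite_Diff)
  let ?h = "\<lambda>x. if x \<in> X then f x else g x"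
  have "bij_betw ?h X Y" using f by (rule bij_betw_cong[THEN iffD1, rotated]) auto
  moreover have "bij_betw ?h (S - X) (S - Y)" using g by (rule bij_betw_cong[THEN iffD1, rotated]) auto
  ultimately have "bij_betw ?h (X \<union> (S - X)) (Y \<union> (S - Y))" by (rule bij_betw_combine) auto
  moreover have "X \<union> (S - X) = S" "Y \<union> (S - Y) = S" using assms by auto
  ultimately have h: "bij_betw ?h S S" by simp
  have "restrict_id ?h S permutes S" using h by (rule permutes_restrict_id)
  moreover have "restrict_id ?h S ` X = f ` X" using assms(2)
    by (intro image_cong) (auto simp: restrict_id_def)
  ultimately show ?thesis using bij_betw_imp_surj_on[OF f] by (intro exI[of _ "restrict_id ?h S"]) simp
qed

text \<open>Left composition with a permutation that takes \<open>Y'\<close> to \<open>Y\<close>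
  injects the permutations sending \<open>X\<close> to \<open>Y'\<close> into those sending
  \<open>X\<close> to \<open>Y\<close>. Hence all \<open>k\<close>-subsets are equally likely images
  of \<open>X\<close>.\<close>

lemma prob_permutes_image:
  assumes "finite S" "X \<subseteq> S" "Y \<subseteq> S" "card X = k" "card Y = k"
  shows "measure_pmf.prob (pmf_of_set {p. p permutes S}) {p. p ` X = Y} = 1 / real (card S choose k)"
proof -
  let ?P = "\<lambda>Y. {p. p permutes S} \<inter> {p. p ` X = Y}"
  let ?K = "{Y. Y \<subseteq> S \<and> card Y = k}"
  have same: "card (?P Y') \<le> card (?P Y)" if "Y \<in> ?K" "Y' \<in> ?K" for Y Y'
  proof -
    obtain q where q: "q permutes S" "q ` Y' = Y"
      using ex_permutes_image[OF assms(1), of Y' Y] \<open>Y \<in> ?K\<close> \<open>Y' \<in> ?K\<close> by auto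
    show ?thesis
    proof (rule card_inj_on_le)
      show "inj_on ((\<circ>) q) (?P Y')"
        using permutes_inj[OF q(1)] fun.inj_map inj_on_subset by blast
      show "(\<circ>) q ` ?P Y' \<subseteq> ?P Y"
      proof (intro image_subsetI IntI CollectI)
        fix p assume p: "p \<in> ?P Y'"
        show "q \<circ> p permutes S" using p q(1) by (blast intro: permutes_compose)
        have "p ` X = Y'" using p by blast
        then show "(q \<circ> p) ` X = Y" using q(2) by (simp only: image_comp[symmetric])
      qed
      show "finite (?P Y)" using assms(1) by (simp add: finite_permutations)
    qed
  qed
  have finK: "finite ?K" using assms(1) by simp
  have "{p. p permutes S} = (\<Union>Y\<in>?K. ?P Y)"
  proof (intro equalityI subsetI)
    fix p assume "p \<in> {p. p permutes S}"
    then have p: "p permutes S" by simp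
    have "p ` X \<subseteq> S" using assms(2) permutes_image[OF p] by blast
    moreover have "card (p ` X) = k" using assms(4) card_image[OF permutes_inj_on[OF p]] by metis
    ultimately show "p \<in> (\<Union>Y\<in>?K. ?P Y)" using p by blast
  qed blast
  then have "card {p. p permutes S} = card (\<Union>Y\<in>?K. ?P Y)" by (rule arg_cong)
  also have "\<dots> = (\<Sum>Y'\<in>?K. card (?P Y'))"
    by (rule card_UN_disjoint) (use assms(1) finK in \<open>auto simp: finite_permutations\<close>)
  also have "\<dots> = (\<Sum>Y'\<in>?K. card (?P Y))"
    using same assms by (intro sum.cong refl antisym) auto
  also have "\<dots> = (card S choose k) * card (?P Y)"
    using assms(1) by (simp add: n_subsets)
  finally have *: "card {p. p permutes S} = (card S choose k) * card (?P Y)" .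
  have "card {p. p permutes S} > 0" using card_permutations[OF refl assms(1)] by simp
  then have "card (?P Y) > 0" unfolding * by simp
  moreover have "measure_pmf.prob (pmf_of_set {p. p permutes S}) {p. p ` X = Y}
      = real (card (?P Y)) / real (card {p. p permutes S})"
    using assms(1) permutes_id[of S] by (intro measure_pmf_of_set finite_permutations) blast+
  ultimately show ?thesis by (simp add: *)
qed

section \<open>Permutations consisting of a single cycle\<close>

text \<open>The iterates before the first return to \<open>x\<close> are distinct and exhaust the
  orbit, which is \<open>S\<close>; so the first return takes exactly \<open>card S\<close>
  steps.\<close>

lemma cyclic_on_iterates:
  assumes "cyclic_on f S" "x \<in> S"
  shows "bij_betw (\<lambda>i. (f ^^ i) x) {0..<card S} S" "(f ^^ card S) x = x"
proof -
  let ?d = "funpow_dist1 f x x"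
  have orb: "orbit f x = S" using assms by (rule orbit_cyclic_eq3)
  then have self: "x \<in> orbit f x" using assms(2) by simp
  have bij: "bij_betw (\<lambda>i. (f ^^ i) x) {0..<?d} S"
    using inj_on_funpow_dist1[OF self] orbit_conv_funpow_dist1[OF self] orb
    by (simp add: bij_betw_def)
  then have d: "?d = card S" using bij_betw_same_card by fastforce
  show "bij_betw (\<lambda>i. (f ^^ i) x) {0..<card S} S" using bij unfolding d .
  show "(f ^^ card S) x = x" using funpow_dist1_prop[OF self] unfolding d .
qed

text \<open>A cyclic permutation together with a starting point is determined by the list of iterates.\<close>

lemma card_cyclic_permutations_le:
  assumes "finite S"
  shows "card {\<sigma>. \<sigma> permutes S \<and> cyclic_on \<sigma> S} * card S \<le> fact (card S)"
proof -
  let ?C = "{\<sigma>. \<sigma> permutes S \<and> cyclic_on \<sigma> S}"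
  let ?n = "card S"
  let ?L = "\<lambda>(\<sigma>, j). map (\<lambda>i. (\<sigma> ^^ i) j) [0..<?n]"
  have "card (?C \<times> S) \<le> card (permutations_of_set S)"
  proof (rule card_inj_on_le)
    show "?L ` (?C \<times> S) \<subseteq> permutations_of_set S"
    proof clarify
      fix \<sigma> j assume "cyclic_on \<sigma> S" "j \<in> S"
      then have "bij_betw (\<lambda>i. (\<sigma> ^^ i) j) {0..<?n} S" by (rule cyclic_on_iterates)
      then show "map (\<lambda>i. (\<sigma> ^^ i) j) [0..<?n] \<in> permutations_of_set S"
        by (auto simp: permutations_of_set_def distinct_map bij_betw_def)
    qed
    show "inj_on ?L (?C \<times> S)"
    proof (rule inj_onI, clarify)
      fix \<sigma> \<tau> i j
      assume \<sigma>: "\<sigma> permutes S" "cyclic_on \<sigma> S" "i \<in> S" and \<tau>: "\<tau> permutes S" "cyclic_on \<tau> S" "j \<in> S"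
        and eq: "map (\<lambda>k. (\<sigma> ^^ k) i) [0..<?n] = map (\<lambda>k. (\<tau> ^^ k) j) [0..<?n]"
      have eq: "(\<sigma> ^^ k) i = (\<tau> ^^ k) j" if "k < ?n" for k
        using arg_cong[OF eq, of "\<lambda>xs. xs ! k"] that by simp
      have "?n > 0" using assms \<sigma>(3) by (auto simp: card_gt_0_iff)
      then have ij: "i = j" using eq[of 0] by simp
      \<comment> \<open>The lists record exponents below \<open>?n\<close> only. At
        \<open>?n\<close> both iterates are back at the common start, which also settles the image
        of the last entry.\<close>
      have eq': "(\<sigma> ^^ k) i = (\<tau> ^^ k) j" if "k \<le> ?n" for k
        using eq[of k] that ij cyclic_on_iterates(2)[OF \<sigma>(2,3)] cyclic_on_iterates(2)[OF \<tau>(2,3)]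
        by (cases "k = ?n") auto
      have "\<sigma> x = \<tau> x" for x
      proof (cases "x \<in> S")
        case True
        then have "x \<in> (\<lambda>k. (\<sigma> ^^ k) i) ` {0..<?n}"
          by (simp only: bij_betw_imp_surj_on[OF cyclic_on_iterates(1)[OF \<sigma>(2,3)]])
        then obtain k where k: "k < ?n" "x = (\<sigma> ^^ k) i" by auto
        have "\<sigma> x = (\<sigma> ^^ Suc k) i" by (simp add: k)
        also have "\<dots> = (\<tau> ^^ Suc k) j" using k by (intro eq') simp
        also have "\<dots> = \<tau> x" using eq[OF k(1)] by (simp add: k)
        finally show ?thesis .
      qed (use \<sigma>(1) \<tau>(1) in \<open>simp add: permutes_not_in\<close>)
      then show "\<sigma> = \<tau> \<and> i = j" using ij by auto
    qed
  qed simp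
  then show ?thesis using assms by (simp add: card_cartesian_product)
qed

text \<open>Composing with fixed permutations on both sides is injective, so the count of cyclic
  permutations still bounds the favourable cases. The factors \<open>p\<close> and \<open>q\<close>
  will carry the permutation of one edge along a tree into a single fibre.\<close>

lemma prob_cyclic_conjugate_le:
  assumes "finite S" "S \<noteq> {}" "p permutes S" "q permutes S"
  shows "measure_pmf.prob (pmf_of_set {\<pi>. \<pi> permutes S}) {\<pi>. cyclic_on (p \<circ> \<pi> \<circ> q) S} \<le> 1 / card S"
proof -
  let ?P = "{\<pi>. \<pi> permutes S}"
  let ?C = "{\<sigma>. \<sigma> permutes S \<and> cyclic_on \<sigma> S}"
  have "card (?P \<inter> {\<pi>. cyclic_on (p \<circ> \<pi> \<circ> q) S}) \<le> card ?C"
  proof (rule card_inj_on_le)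
    show "inj_on (\<lambda>\<pi>. p \<circ> \<pi> \<circ> q) (?P \<inter> {\<pi>. cyclic_on (p \<circ> \<pi> \<circ> q) S})"
    proof (rule inj_onI)
      fix x y assume eq: "p \<circ> x \<circ> q = p \<circ> y \<circ> q"
      have "x i = y i" for i
        using fun_cong[OF eq, of "inv q i"] permutes_inverses[OF assms(4)] permutes_inj[OF assms(3)]
        by (simp add: inj_eq)
      then show "x = y" by auto
    qed
    show "(\<lambda>\<pi>. p \<circ> \<pi> \<circ> q) ` (?P \<inter> {\<pi>. cyclic_on (p \<circ> \<pi> \<circ> q) S}) \<subseteq> ?C"
      using assms(3,4) by (auto intro!: permutes_compose)
    show "finite ?C" using finite_permutations[OF assms(1)] by (rule rev_finite_subset) auto
  qed
  then have "card (?P \<inter> {\<pi>. cyclic_on (p \<circ> \<pi> \<circ> q) S}) * card S \<le> card ?P"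
    unfolding card_permutations[OF refl assms(1)]
    by (rule mult_le_mono1[THEN order.trans, OF _ card_cyclic_permutations_le[OF assms(1)]])
  then have "real (card (?P \<inter> {\<pi>. cyclic_on (p \<circ> \<pi> \<circ> q) S})) * real (card S) \<le> real (card ?P)"
    by (simp only: of_nat_mult[symmetric] of_nat_le_iff)
  moreover have "0 < real (card S)" using assms by (simp add: card_gt_0_iff)
  moreover have "0 < real (card ?P)" using card_permutations[OF refl assms(1)] by simp
  ultimately have "real (card (?P \<inter> {\<pi>. cyclic_on (p \<circ> \<pi> \<circ> q) S})) / real (card ?P) \<le> 1 / card S"
    by (simp only: pos_divide_le_eq pos_le_divide_eq times_divide_eq_left mult_1_left)
  moreover have "measure_pmf.prob (pmf_of_set ?P) {\<pi>. cyclic_on (p \<circ> \<pi> \<circ> q) S}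
      = real (card (?P \<inter> {\<pi>. cyclic_on (p \<circ> \<pi> \<circ> q) S})) / real (card ?P)"
    using assms(1) permutes_id[of S] by (intro measure_pmf_of_set finite_permutations) blast+
  ultimately show ?thesis by simp
qed

section \<open>Conditioning on one factor of a product distribution\<close>

text \<open>The probability of \<open>X\<close> is the average over \<open>y\<close> of the
  probabilities of its sections, so a uniform bound on the sections carries over.\<close>

lemma prob_pair_pmf_le:
  assumes "\<And>y. y \<in> set_pmf N \<Longrightarrow> measure_pmf.prob M {x. (x, y) \<in> X} \<le> c"
  shows "measure_pmf.prob (pair_pmf M N) X \<le> c"
proof -
  obtain y0 where "y0 \<in> set_pmf N" using set_pmf_not_empty[of N] by blast
  \<comment> \<open>Nonnegativity keeps \<open>ennreal c\<close> from truncating the bound to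
    zero.\<close>
  then have c: "c \<ge> 0" using assms measure_nonneg order_trans by blast
  have "emeasure (pair_pmf M N) X = emeasure (bind_pmf N (\<lambda>y. map_pmf (\<lambda>x. (x, y)) M)) X"
    by (subst pair_commute_pmf) (simp add: pair_pmf_def map_pmf_def bind_assoc_pmf bind_return_pmf)
  also have "\<dots> = (\<integral>\<^sup>+y. emeasure (map_pmf (\<lambda>x. (x, y)) M) X \<partial>N)" by simp
  also have "\<dots> \<le> (\<integral>\<^sup>+y. ennreal c \<partial>N)"
  proof (rule nn_integral_mono_AE, rule AE_pmfI)
    fix y assume "y \<in> set_pmf N"
    then have "measure_pmf.prob M {x. (x, y) \<in> X} \<le> c" by (rule assms)
    then show "emeasure (map_pmf (\<lambda>x. (x, y)) M) X \<le> ennreal c"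
      by (simp add: measure_pmf.emeasure_eq_measure vimage_def c)
  qed
  also have "\<dots> = ennreal c" by simp
  finally show ?thesis using c by (simp add: measure_pmf.emeasure_eq_measure)
qed

section \<open>Decay of reciprocal powers of binomial coefficients\<close>

text \<open>This rests on \<open>(n choose j) \<ge> (n / j) ^ j\<close>. Keeping \<open>k\<close>
  apart from \<open>j\<close> gives one bound for all \<open>k\<close> whose binomial coefficient
  dominates that of \<open>j\<close>.\<close>

lemma inverse_binomial_power_le:
  assumes "0 < j" "j \<le> n" "n choose j \<le> n choose k"
  shows "1 / real (n choose k) ^ m \<le> real (j ^ j) ^ m / real n ^ (j * m)"
proof -
  have "(real n / real j) ^ j \<le> real (n choose j)"
    using assms(2) by (rule binomial_ge_n_over_k_pow_k)
  also have "\<dots> \<le> real (n choose k)" using assms(3) by simp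
  finally have le: "((real n / real j) ^ j) ^ m \<le> real (n choose k) ^ m" by (rule power_mono) simp
  have pos: "0 < ((real n / real j) ^ j) ^ m" using assms by simp
  have "1 / real (n choose k) ^ m \<le> 1 / ((real n / real j) ^ j) ^ m"
    by (rule frac_le[OF _ order_refl pos le]) simp
  also have "\<dots> = real (j ^ j) ^ m / real n ^ (j * m)"
    by (simp add: power_divide power_mult)
  finally show ?thesis .
qed

text \<open>The true decay is of order \<open>2 * m\<close>, which is at least \<open>m + 1\<close>
  once \<open>m \<ge> 1\<close>; for \<open>m = 0\<close> nothing decays.\<close>

lemma inverse_choose_2_power_le:
  assumes "2 \<le> n" "1 \<le> m"
  shows "1 / real (n choose 2) ^ m \<le> 4 ^ m / real n ^ (m + 1)"
proof -
  have "1 / real (n choose 2) ^ m \<le> 4 ^ m / real n ^ (2 * m)"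
    using inverse_binomial_power_le[of 2 n 2 m] assms by simp
  also have "\<dots> \<le> 4 ^ m / real n ^ (m + 1)"
    using assms by (intro divide_left_mono power_increasing) auto
  finally show ?thesis .
qed

text \<open>The term \<open>k = 1\<close> is the main term. From \<open>k = 3\<close> on, each of at
  most \<open>n\<close> terms is of order \<open>n ^ -(m + 2)\<close>, which leaves order
  \<open>n ^ -(m + 1)\<close> after summation. The term \<open>k = 2\<close> is kept apart because
  for \<open>m = 1\<close> its bound would not survive a factor \<open>n\<close>.\<close>

lemma sum_inverse_binomial_power_le:
  assumes "0 < n" "1 \<le> m"
  shows "(\<Sum>k=1..n div 2. 1 / real (n choose k) ^ m) \<le> 1 / real n ^ m + (4 ^ m + 27 ^ m) / real n ^ (m + 1)"
proof -
  let ?a = "1 / real n ^ m" and ?b = "4 ^ m / real n ^ (m + 1)" and ?c = "27 ^ m / real n ^ (m + 2)"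
  have "(\<Sum>k=1..n div 2. 1 / real (n choose k) ^ m)
      \<le> (\<Sum>k=1..n div 2. (if k = 1 then ?a else 0) + (if k = 2 then ?b else 0) + ?c)"
  proof (rule sum_mono)
    fix k assume k: "k \<in> {1..n div 2}"
    consider "k = 1" | "k = 2" | "3 \<le> k" using k by fastforce
    then show "1 / real (n choose k) ^ m \<le> (if k = 1 then ?a else 0) + (if k = 2 then ?b else 0) + ?c"
    proof cases
      case 2
      then have "1 / real (n choose 2) ^ m \<le> ?b" using k assms by (intro inverse_choose_2_power_le) auto
      then show ?thesis using 2 by (simp add: add_increasing2)
    next
      case 3
      have "1 / real (n choose k) ^ m \<le> 27 ^ m / real n ^ (3 * m)"
        using inverse_binomial_power_le[of 3 n k m] 3 k by (simp add: binomial_mono)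
      also have "\<dots> \<le> ?c" using assms by (intro divide_left_mono power_increasing) auto
      finally show ?thesis using 3 by simp
    qed simp
  qed
  also have "\<dots> = (\<Sum>k=1..n div 2. if k = 1 then ?a else 0) + (\<Sum>k=1..n div 2. if k = 2 then ?b else 0)
      + real (n div 2) * ?c"
    by (simp add: sum.distrib)
  also have "(\<Sum>k=1..n div 2. if k = 1 then ?a else 0) \<le> ?a" by (subst sum.delta) auto
  also have "(\<Sum>k=1..n div 2. if k = 2 then ?b else 0) \<le> ?b" by (subst sum.delta) auto
  also have "real (n div 2) * ?c \<le> real n * ?c" by (intro mult_right_mono) auto
  also have "real n * ?c = 27 ^ m / real n ^ (m + 1)" using assms by (simp add: field_simps)
  finally show ?thesis by (simp add: add_divide_distrib)
qed

section \<open>Lifts of a fixed graph and their closed families\<close>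

locale graph_lift =
  fixes G :: "'a pair_pre_digraph" and A :: "'a rel"
  assumes pair_graph: "pair_graph G"
    and connected: "graph_connected G"
    and orientation: "orientation G A"
begin

lemma finite_verts: "finite (pverts G)"
  using pair_graph by (simp add: pair_graph_def pair_digraph_def pair_fin_digraph_def pair_fin_digraph_axioms_def)

lemma verts_nonempty: "pverts G \<noteq> {}"
  using graph_connected_iff_no_closed_set[OF pair_graph] connected by blast

lemma arcs_in_verts:
  assumes "(u, v) \<in> A" shows "u \<in> pverts G" "v \<in> pverts G"
proof -
  interpret pair_graph G by (rule pair_graph)
  show "u \<in> pverts G" "v \<in> pverts G"
    using assms orientation by (auto simp: orientation_def dest: in_arcsD1 in_arcsD2)
qed

lemma finite_arcs: "finite A"
proof -
  have "A \<subseteq> pverts G \<times> pverts G" using arcs_in_verts by auto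
  then show ?thesis using finite_verts finite_subset by blast
qed

text \<open>\<open>A\<close> contains only one arc of each edge, so closure in \<open>G\<close>
  requires membership to pass along \<open>A\<close> in both directions.\<close>

lemma closed_eq_verts:
  assumes "X \<subseteq> pverts G" "X \<noteq> {}" "\<And>u v. (u, v) \<in> A \<Longrightarrow> u \<in> X \<longleftrightarrow> v \<in> X"
  shows "X = pverts G"
proof -
  have "y \<in> X" if "(x, y) \<in> parcs G" "x \<in> X" for x y
    using that assms(3) orientation by (auto simp: orientation_def)
  then show ?thesis
    using graph_connected_iff_no_closed_set[OF pair_graph] connected assms(1,2) by blast
qed

text \<open>Fixing the value \<open>id\<close> outside \<open>A\<close> makes this finite set the
  support of \<open>Pi_pmf\<close>, which is then the uniform distribution on it.\<close>

definition lifts :: "nat \<Rightarrow> ('a \<times> 'a \<Rightarrow> nat \<Rightarrow> nat) set" where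
  "lifts n = PiE_dflt A id (\<lambda>_. {p. p permutes {1..n}})"

text \<open>\<open>S v\<close> is the slice over \<open>v\<close> of a union of components.
  Extensionality makes each union correspond to one function, so that families can be
  counted.\<close>

definition closed_families :: "nat \<Rightarrow> nat \<Rightarrow> ('a \<times> 'a \<Rightarrow> nat \<Rightarrow> nat) \<Rightarrow> ('a \<Rightarrow> nat set) set" where
  "closed_families n k \<pi> =
     {S \<in> pverts G \<rightarrow>\<^sub>E {X. X \<subseteq> {1..n} \<and> card X = k}. \<forall>(u, v) \<in> A. \<pi> (u, v) ` S u = S v}"

lemma lifts_permutes: "\<pi> \<in> lifts n \<Longrightarrow> e \<in> A \<Longrightarrow> \<pi> e permutes {1..n}"
  unfolding lifts_def PiE_dflt_def by blast

lemma finite_lifts: "finite (lifts n)"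
  unfolding lifts_def using finite_arcs by (intro finite_PiE_dflt) (auto simp: finite_permutations)

lemma lifts_nonempty: "lifts n \<noteq> {}"
  unfolding lifts_def PiE_dflt_empty_iff using permutes_id by blast

lemma Pi_pmf_eq_lifts:
  "Pi_pmf A id (\<lambda>_. pmf_of_set {p. p permutes {1..n}}) = pmf_of_set (lifts n)"
  unfolding lifts_def using finite_arcs permutes_id[of "{1..n}"]
  by (intro Pi_pmf_of_set finite_permutations) blast+

lemma closed_familiesD:
  assumes "S \<in> closed_families n k \<pi>"
  shows "\<And>v. v \<in> pverts G \<Longrightarrow> S v \<subseteq> {1..n}" "\<And>v. v \<in> pverts G \<Longrightarrow> card (S v) = k"
    "\<And>u v. (u, v) \<in> A \<Longrightarrow> \<pi> (u, v) ` S u = S v" "S \<in> extensional (pverts G)"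
  using assms unfolding closed_families_def PiE_iff by blast+

lemma closed_familiesI:
  assumes "S \<in> extensional (pverts G)"
    and "\<And>v. v \<in> pverts G \<Longrightarrow> S v \<subseteq> {1..n}" "\<And>v. v \<in> pverts G \<Longrightarrow> card (S v) = k"
    and "\<And>u v. (u, v) \<in> A \<Longrightarrow> \<pi> (u, v) ` S u = S v"
  shows "S \<in> closed_families n k \<pi>"
  using assms unfolding closed_families_def PiE_iff by blast

lemma finite_closed_families: "finite (closed_families n k \<pi>)"
proof (rule finite_subset)
  show "closed_families n k \<pi> \<subseteq> pverts G \<rightarrow>\<^sub>E Pow {1..n}"
    unfolding closed_families_def by (intro Collect_restrict[THEN order.trans] PiE_mono) auto
  show "finite (pverts G \<rightarrow>\<^sub>E Pow {1..n})" using finite_verts by (intro finite_PiE) auto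
qed

text \<open>The slices assemble to a closed vertex set of the lift, nonempty by \<open>0 < k\<close>
  and proper by \<open>k < n\<close>.\<close>

lemma closed_families_disconnect:
  assumes "\<pi> \<in> lifts n" "S \<in> closed_families n k \<pi>" "0 < k" "k < n"
  shows "\<not> graph_connected (lift_graph G A n \<pi>)"
proof
  assume conn: "graph_connected (lift_graph G A n \<pi>)"
  note S = closed_familiesD[OF assms(2)]
  obtain v where v: "v \<in> pverts G" using verts_nonempty by auto
  define X where "X = Sigma (pverts G) S"
  have "X \<subseteq> pverts (lift_graph G A n \<pi>)"
    using S(1) by (auto simp: X_def lift_graph_def Let_def)
  moreover have "S v \<noteq> {}" using S(2)[OF v] assms(3) by auto
  then have "X \<noteq> {}" using v by (auto simp: X_def)
  \<comment> \<open>Lift arcs occur in both directions; injectivity of \<open>\<pi> (u, v)\<close>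
    carries membership backwards.\<close>
  moreover have "j \<in> S v \<longleftrightarrow> i \<in> S u" if "(u, v) \<in> A" "\<pi> (u, v) i = j" for u v i j
    using S(3)[OF that(1)] that(2) permutes_inj[OF lifts_permutes[OF assms(1) that(1)]]
    by (metis image_iff inj_eq)
  then have "\<forall>(x, y)\<in>parcs (lift_graph G A n \<pi>). x \<in> X \<longrightarrow> y \<in> X"
    by (auto simp: X_def lift_graph_def Let_def dest: arcs_in_verts)
  ultimately have "X = pverts (lift_graph G A n \<pi>)"
    using conn graph_connected_iff_no_closed_set[OF pair_graph_lift_graph[OF pair_graph orientation]]
    by blast
  then have "S v = {1..n}" using v by (auto simp: X_def lift_graph_def Let_def)
  then show False using S(2)[OF v] assms(4) by simp
qed

text \<open>Bijections commute with complements; this allows restricting to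
  \<open>k \<le> n div 2\<close>.\<close>

lemma closed_families_complement:
  assumes "\<pi> \<in> lifts n" "S \<in> closed_families n k \<pi>"
  shows "(\<lambda>v\<in>pverts G. {1..n} - S v) \<in> closed_families n (n - k) \<pi>"
proof -
  note S = closed_familiesD[OF assms(2)]
  have "card ({1..n} - S v) = n - k" if "v \<in> pverts G" for v
    using S(1,2)[OF that] by (subst card_Diff_subset) (auto intro: finite_subset)
  moreover have "\<pi> (u, v) ` ({1..n} - S u) = {1..n} - S v" if "(u, v) \<in> A" for u v
    using lifts_permutes[OF assms(1) that] S(3)[OF that]
    by (simp add: image_set_diff permutes_inj permutes_image)
  ultimately show ?thesis by (intro closed_familiesI) (auto simp: arcs_in_verts)
qed

text \<open>Slice a proper closed vertex set by fibres. Since the lift contains each arc in both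
  directions, every \<open>\<pi> (u, v)\<close> maps slice onto slice, so the slices form a closed
  family, replaced by its complement if they are too large.\<close>

lemma disconnected_closed_families:
  assumes "\<pi> \<in> lifts n" "0 < n" "\<not> graph_connected (lift_graph G A n \<pi>)"
  shows "\<exists>k\<in>{1..n div 2}. closed_families n k \<pi> \<noteq> {}"
proof -
  let ?V = "pverts G \<times> {1..n}"
  let ?H = "lift_graph G A n \<pi>"
  have V: "pverts ?H = ?V" by (simp add: lift_graph_def Let_def)
  have "?V \<noteq> {}" using verts_nonempty assms(2) by (auto simp: Suc_le_eq)
  then obtain X where X: "X \<subseteq> ?V" "X \<noteq> {}" "X \<noteq> ?V" "\<forall>(x, y)\<in>parcs ?H. x \<in> X \<longrightarrow> y \<in> X"
    using assms(3) graph_connected_iff_no_closed_set[OF pair_graph_lift_graph[OF pair_graph orientation, of n \<pi>]]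
    unfolding V by auto
  obtain w i0 where w: "(w, i0) \<in> X" using X(2) by auto
  have wV: "w \<in> pverts G" using w X(1) by auto
  define S where "S = (\<lambda>v\<in>pverts G. X `` {v})"
  define k where "k = card (S w)"
  have Ssub: "S v \<subseteq> {1..n}" if "v \<in> pverts G" for v
    using that X(1) by (auto simp: S_def)
  have img: "\<pi> (u, v) ` S u = S v" if uv: "(u, v) \<in> A" for u v
  proof -
    note p = lifts_permutes[OF assms(1) uv]
    have arc: "((u, i), (v, \<pi> (u, v) i)) \<in> parcs ?H" "((v, \<pi> (u, v) i), (u, i)) \<in> parcs ?H"
      if "i \<in> {1..n}" for i
      using uv that permutes_in_image[OF p, of i] by (auto simp: lift_graph_def Let_def)
    have "i \<in> S u \<longleftrightarrow> \<pi> (u, v) i \<in> S v" if "i \<in> {1..n}" for i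
      using arc[OF that] X(4) arcs_in_verts[OF uv] by (auto simp: S_def)
    moreover have "S v \<subseteq> \<pi> (u, v) ` {1..n}"
      using permutes_image[OF p] Ssub arcs_in_verts[OF uv] by auto
    ultimately show ?thesis using Ssub[OF arcs_in_verts(1)[OF uv]] by blast
  qed
  have "card (S u) = card (S v)" if "(u, v) \<in> A" for u v
    using img[OF that] permutes_inj_on[OF lifts_permutes[OF assms(1) that]] by (metis card_image)
  \<comment> \<open>Slice size is constant along arcs, hence on all of the connected graph
    \<open>G\<close>.\<close>
  then have "{v \<in> pverts G. card (S v) = k} = pverts G"
    by (intro closed_eq_verts) (use wV in \<open>auto simp: k_def dest: arcs_in_verts\<close>)
  then have card: "card (S v) = k" if "v \<in> pverts G" for v using that by auto
  have S: "S \<in> closed_families n k \<pi>"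
    using Ssub card img by (intro closed_familiesI) (auto simp: S_def)
  have "i0 \<in> S w" using w wV by (auto simp: S_def)
  then have "k > 0" unfolding k_def using Ssub[OF wV] finite_subset by (fastforce simp: card_gt_0_iff)
  have "k < n"
  proof (rule ccontr)
    assume "\<not> k < n"
    then have "S v = {1..n}" if "v \<in> pverts G" for v
      using Ssub[OF that] card[OF that] by (intro card_seteq) auto
    then have "?V \<subseteq> X" by (auto simp: S_def)
    then show False using X by auto
  qed
  show ?thesis
  proof (cases "k \<le> n div 2")
    case True
    then show ?thesis using S \<open>k > 0\<close> by (intro bexI[of _ k]) auto
  next
    case False
    then show ?thesis using closed_families_complement[OF assms(1) S] \<open>k < n\<close>
      by (intro bexI[of _ "n - k"]) auto
  qed
qed

text \<open>Distinct closed families of singletons are disjoint, so adding one of them to all the others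
  produces distinct closed families of pairs.\<close>

lemma card_closed_families_1_le:
  assumes "\<pi> \<in> lifts n"
  shows "card (closed_families n 1 \<pi>) \<le> Suc (card (closed_families n 2 \<pi>))"
proof (cases "closed_families n 1 \<pi> = {}")
  case False
  then obtain S0 where S0: "S0 \<in> closed_families n 1 \<pi>" by auto
  note D = closed_familiesD
  have disj: "S v \<inter> S0 v = {}"
    if S: "S \<in> closed_families n 1 \<pi> - {S0}" and v: "v \<in> pverts G" for S v
  proof (rule ccontr)
    assume *: "S v \<inter> S0 v \<noteq> {}"
    have "card (S v) = 1" "card (S0 v) = 1" using S S0 v by (auto intro: D)
    with * have eq: "S v = S0 v" by (auto simp: card_1_singleton_iff)
    \<comment> \<open>Agreement at one vertex spreads along arcs in both directions, because each
      permutation is injective.\<close>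
    have "{v \<in> pverts G. S v = S0 v} = pverts G"
    proof (rule closed_eq_verts)
      fix a b assume ab: "(a, b) \<in> A"
      have "\<pi> (a, b) ` S a = S b" "\<pi> (a, b) ` S0 a = S0 b" using S S0 ab D(3) by blast+
      moreover have "inj (\<pi> (a, b))" using lifts_permutes[OF assms ab] by (rule permutes_inj)
      ultimately have "S a = S0 a \<longleftrightarrow> S b = S0 b" by (metis inj_image_eq_iff)
      then show "a \<in> {v \<in> pverts G. S v = S0 v} \<longleftrightarrow> b \<in> {v \<in> pverts G. S v = S0 v}"
        using arcs_in_verts[OF ab] by simp
    qed (use eq v in auto)
    then have "S = S0" using S S0 by (intro extensionalityI[of _ "pverts G"]) (auto intro: D)
    then show False using S by simp
  qed
  define U where "U S = (\<lambda>v\<in>pverts G. S v \<union> S0 v)" for S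
  have "inj_on U (closed_families n 1 \<pi> - {S0})"
  proof (rule inj_onI)
    fix S T assume ST: "S \<in> closed_families n 1 \<pi> - {S0}" "T \<in> closed_families n 1 \<pi> - {S0}" "U S = U T"
    show "S = T"
    proof (rule extensionalityI[of _ "pverts G"])
      fix v assume v: "v \<in> pverts G"
      have "S v \<union> S0 v = T v \<union> S0 v" using fun_cong[OF ST(3), of v] v by (simp add: U_def)
      then show "S v = T v" using disj[OF ST(1) v] disj[OF ST(2) v] by blast
    qed (use ST in \<open>auto intro: D\<close>)
  qed
  moreover have "U S \<in> closed_families n 2 \<pi>" if S: "S \<in> closed_families n 1 \<pi> - {S0}" for S
  proof -
    have "card (S v \<union> S0 v) = 2" if v: "v \<in> pverts G" for v
    proof -
      have "card (S v) = 1" "card (S0 v) = 1" using S S0 v by (auto intro: D)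
      then show ?thesis using disj[OF S v] by (auto simp: card_1_singleton_iff)
    qed
    moreover have "S v \<union> S0 v \<subseteq> {1..n}" if "v \<in> pverts G" for v
      using D(1)[OF S0 that] D(1)[OF _ that, of S n 1 \<pi>] S by blast
    moreover have "\<pi> (u, v) ` (S u \<union> S0 u) = S v \<union> S0 v" if "(u, v) \<in> A" for u v
      using D(3)[OF S0 that] D(3)[OF _ that, of S n 1 \<pi>] S by (simp add: image_Un)
    ultimately show ?thesis by (intro closed_familiesI) (auto simp: U_def arcs_in_verts)
  qed
  ultimately have "card (closed_families n 1 \<pi> - {S0}) \<le> card (closed_families n 2 \<pi>)"
    by (intro card_inj_on_le[of U]) (auto simp: finite_closed_families)
  then show ?thesis using S0 by (simp add: finite_closed_families)
qed simp


section \<open>First moments and bounds on the probability of disconnection\<close>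

text \<open>By linearity, sum over all candidate families. For a fixed \<open>S\<close> the
  conditions at different arcs involve independent permutations, and each holds with probability
  \<open>1 / (n choose k)\<close>.\<close>

lemma expectation_card_closed_families:
  assumes "k \<le> n"
  shows "measure_pmf.expectation (pmf_of_set (lifts n)) (\<lambda>\<pi>. real (card (closed_families n k \<pi>)))
    = real (n choose k) ^ card (pverts G) / real (n choose k) ^ card A"
proof -
  let ?M = "pmf_of_set (lifts n)"
  let ?F = "pverts G \<rightarrow>\<^sub>E {X. X \<subseteq> {1..n} \<and> card X = k}"
  let ?E = "\<lambda>S. {\<pi>. \<forall>(u, v) \<in> A. \<pi> (u, v) ` S u = S v}"
  have finF: "finite ?F" using finite_verts by (intro finite_PiE) auto
  have "real (card (closed_families n k \<pi>)) = (\<Sum>S\<in>?F. indicator (?E S) \<pi>)" for \<pi>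
    using sum.inter_filter[OF finF, of "\<lambda>_. 1::real" "\<lambda>S. \<pi> \<in> ?E S"]
    by (simp add: closed_families_def indicator_def of_bool_def)
  then have "measure_pmf.expectation ?M (\<lambda>\<pi>. real (card (closed_families n k \<pi>)))
      = (\<Sum>S\<in>?F. measure_pmf.prob ?M (?E S))"
    by (simp add: measure_pmf.emeasure_eq_measure)
  also have "\<dots> = (\<Sum>S\<in>?F. 1 / real (n choose k) ^ card A)"
  proof (rule sum.cong)
    fix S assume S: "S \<in> ?F"
    have "?E S = Pi A (\<lambda>e. {p. p ` S (fst e) = S (snd e)})"
      by (simp only: Pi_def case_prod_unfold prod.collapse Ball_def mem_Collect_eq)
    then have "measure_pmf.prob ?M (?E S)
        = (\<Prod>e\<in>A. measure_pmf.prob (pmf_of_set {p. p permutes {1..n}}) {p. p ` S (fst e) = S (snd e)})"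
      by (simp only: Pi_pmf_eq_lifts[symmetric] measure_Pi_pmf_Pi[OF finite_arcs])
    also have "\<dots> = (\<Prod>e\<in>A. 1 / real (card {1..n} choose k))"
    proof (rule prod.cong)
      fix e assume "e \<in> A"
      then have "fst e \<in> pverts G" "snd e \<in> pverts G" using arcs_in_verts[of "fst e" "snd e"] by auto
      then have "S (fst e) \<in> {X. X \<subseteq> {1..n} \<and> card X = k}" "S (snd e) \<in> {X. X \<subseteq> {1..n} \<and> card X = k}"
        using PiE_mem[OF S] by blast+
      then show "measure_pmf.prob (pmf_of_set {p. p permutes {1..n}}) {p. p ` S (fst e) = S (snd e)}
          = 1 / real (card {1..n} choose k)" by (intro prob_permutes_image) auto
    qed simp
    finally show "measure_pmf.prob ?M (?E S) = 1 / real (n choose k) ^ card A"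
      by (simp add: power_one_over)
  qed simp
  also have "card ?F = (n choose k) ^ card (pverts G)"
    using finite_verts by (simp add: card_PiE n_subsets)
  then have "(\<Sum>S\<in>?F. 1 / real (n choose k) ^ card A)
      = real (n choose k) ^ card (pverts G) / real (n choose k) ^ card A" by simp
  finally show ?thesis .
qed

lemma prob_random_lift:
  "measure_pmf.prob (random_lift G A n) {H. graph_connected H}
    = 1 - measure_pmf.prob (pmf_of_set (lifts n)) {\<pi>. \<not> graph_connected (lift_graph G A n \<pi>)}"
proof -
  have "measure_pmf.prob (random_lift G A n) {H. graph_connected H}
      = measure_pmf.prob (pmf_of_set (lifts n)) (- {\<pi>. \<not> graph_connected (lift_graph G A n \<pi>)})"
    by (simp only: random_lift_def Pi_pmf_eq_lifts) (simp add: vimage_def Compl_eq)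
  then show ?thesis using measure_pmf.prob_compl[of "{\<pi>. \<not> graph_connected (lift_graph G A n \<pi>)}" "pmf_of_set (lifts n)"]
    by (simp add: Compl_eq_Diff_UNIV)
qed

text \<open>Both bounds integrate a pointwise inequality for the indicator of disconnection: it is
  at most the sum of all \<open>?N k\<close> with \<open>1 \<le> k \<le> n div 2\<close>, and at
  least \<open>?N 1 - ?N 2\<close>.\<close>

lemma prob_disconnected_bounds:
  assumes "2 \<le> n" "card A = card (pverts G) + m"
  shows "measure_pmf.prob (pmf_of_set (lifts n)) {\<pi>. \<not> graph_connected (lift_graph G A n \<pi>)}
      \<le> (\<Sum>k=1..n div 2. 1 / real (n choose k) ^ m)" (is "?D \<le> _")
    and "1 / real n ^ m - 1 / real (n choose 2) ^ m
      \<le> measure_pmf.prob (pmf_of_set (lifts n)) {\<pi>. \<not> graph_connected (lift_graph G A n \<pi>)}"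
proof -
  let ?M = "pmf_of_set (lifts n)"
  let ?N = "\<lambda>k \<pi>. real (card (closed_families n k \<pi>))"
  let ?Dis = "{\<pi>. \<not> graph_connected (lift_graph G A n \<pi>)}"
  have fin: "finite (set_pmf ?M)" using finite_lifts lifts_nonempty by simp
  have int: "integrable ?M f" for f :: "_ \<Rightarrow> real" using fin by (rule integrable_measure_pmf_finite)
  have E: "measure_pmf.expectation ?M (?N k) = 1 / real (n choose k) ^ m" if "k \<le> n" for k
    using that by (simp add: expectation_card_closed_families assms(2) power_add)
  have D: "?D = measure_pmf.expectation ?M (indicator ?Dis)" by simp
  have AE: "AE \<pi> in ?M. P \<pi>" if "\<And>\<pi>. \<pi> \<in> lifts n \<Longrightarrow> P \<pi>" for P
    using that finite_lifts lifts_nonempty by (intro AE_pmfI) simp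
  have "?D \<le> measure_pmf.expectation ?M (\<lambda>\<pi>. \<Sum>k=1..n div 2. ?N k \<pi>)"
    unfolding D
  proof (rule integral_mono_AE[OF int int AE])
    fix \<pi> assume \<pi>: "\<pi> \<in> lifts n"
    show "indicator ?Dis \<pi> \<le> (\<Sum>k=1..n div 2. ?N k \<pi>)"
    proof (cases "\<pi> \<in> ?Dis")
      case True
      then obtain k where k: "k \<in> {1..n div 2}" "closed_families n k \<pi> \<noteq> {}"
        using disconnected_closed_families[OF \<pi>] assms(1) by (metis gr0I mem_Collect_eq not_numeral_le_zero)
      then have "card (closed_families n k \<pi>) \<ge> 1"
        by (simp add: finite_closed_families Suc_le_eq card_gt_0_iff)
      then have "1 \<le> ?N k \<pi>" by linarith
      also have "\<dots> \<le> (\<Sum>k=1..n div 2. ?N k \<pi>)" using k(1) by (intro member_le_sum) auto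
      finally show ?thesis using True by simp
    qed (simp add: sum_nonneg)
  qed
  also have "\<dots> = (\<Sum>k=1..n div 2. measure_pmf.expectation ?M (?N k))"
    using int by (rule Bochner_Integration.integral_sum)
  also have "\<dots> = (\<Sum>k=1..n div 2. 1 / real (n choose k) ^ m)" by (intro sum.cong) (auto simp: E)
  finally show "?D \<le> (\<Sum>k=1..n div 2. 1 / real (n choose k) ^ m)" .
  have "1 / real n ^ m - 1 / real (n choose 2) ^ m = measure_pmf.expectation ?M (\<lambda>\<pi>. ?N 1 \<pi> - ?N 2 \<pi>)"
    using E[of 1] E[of 2] assms(1) by (subst Bochner_Integration.integral_diff[OF int int]) simp
  also have "\<dots> \<le> ?D" unfolding D
  proof (rule integral_mono_AE[OF int int AE])
    fix \<pi> assume \<pi>: "\<pi> \<in> lifts n"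
    show "?N 1 \<pi> - ?N 2 \<pi> \<le> indicator ?Dis \<pi>"
    proof (cases "closed_families n 1 \<pi> = {}")
      case False
      \<comment> \<open>As \<open>1 < n\<close>, a family of singletons is a proper part of the
        lift.\<close>
      then have "\<pi> \<in> ?Dis" using closed_families_disconnect[OF \<pi>, of _ 1] assms(1) by auto
      then show ?thesis using card_closed_families_1_le[OF \<pi>] by simp
    next
      case True
      then have "?N 1 \<pi> - ?N 2 \<pi> \<le> 0" by simp
      also have "0 \<le> indicat_real ?Dis \<pi>" by simp
      finally show ?thesis .
    qed
  qed
  finally show "1 / real n ^ m - 1 / real (n choose 2) ^ m \<le> ?D" .
qed

section \<open>Trivialising a spanning tree and the case of one extra edge\<close>

text \<open>The maps \<open>s v\<close> relabel the fibres so that all permutations on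
  \<open>T\<close> become the identity. Quantifying over \<open>n\<close> and \<open>\<pi>\<close>
  lets \<open>T\<close> be chosen before the permutations are drawn.\<close>

definition lifts_trivial_over :: "'a rel \<Rightarrow> bool" where
  "lifts_trivial_over T \<longleftrightarrow> (\<forall>n \<pi>. (\<forall>e\<in>T. \<pi> e permutes {1..n::nat}) \<longrightarrow>
    (\<exists>s. (\<forall>v. s v permutes {1..n}) \<and> (\<forall>(u, v)\<in>T. \<pi> (u, v) \<circ> s u = s v)))"

lemma lifts_trivial_overE:
  assumes "lifts_trivial_over T" "\<And>e. e \<in> T \<Longrightarrow> \<pi> e permutes {1..n::nat}"
  obtains s where "\<And>v. s v permutes {1..n}" "\<And>u v. (u, v) \<in> T \<Longrightarrow> \<pi> (u, v) \<circ> s u = s v"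
proof -
  have "\<exists>s. (\<forall>v. s v permutes {1..n}) \<and> (\<forall>(u, v)\<in>T. \<pi> (u, v) \<circ> s u = s v)"
    using spec[OF spec[OF assms(1)[unfolded lifts_trivial_over_def], of n], of \<pi>] assms(2) by blast
  then show thesis using that by fast
qed

text \<open>Grow the tree by one vertex at a time. Connectivity yields an arc between
  \<open>W\<close> and its complement, and the labelling at the new vertex is still free, since
  \<open>T \<subseteq> W \<times> W\<close>.\<close>

lemma ex_trivialising_tree:
  assumes "1 \<le> m" "m \<le> card (pverts G)"
  shows "\<exists>W T. W \<subseteq> pverts G \<and> card W = m \<and> T \<subseteq> A \<and> T \<subseteq> W \<times> W \<and> card T = m - 1
    \<and> lifts_trivial_over T"
  using assms
proof (induction m rule: dec_induct)
  case base
  obtain v where "v \<in> pverts G" using verts_nonempty by auto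
  then show ?case
    by (intro exI[of _ "{v}"] exI[of _ "{}"])
      (auto intro!: exI[of _ "\<lambda>_. id"] simp: permutes_id lifts_trivial_over_def)
next
  case (step m)
  then obtain W T where W: "W \<subseteq> pverts G" "card W = m" and T: "T \<subseteq> A" "T \<subseteq> W \<times> W" "card T = m - 1"
    and triv: "lifts_trivial_over T"
    by (meson Suc_leD)
  have "W \<noteq> {}" using W step.hyps by auto
  moreover have "W \<noteq> pverts G" using W step.prems by auto
  ultimately obtain a b where ab: "(a, b) \<in> A" "a \<in> W \<longleftrightarrow> b \<notin> W"
    using closed_eq_verts[OF W(1)] by blast
  define w where "w = (if a \<in> W then b else a)"
  have w: "w \<in> pverts G" "w \<notin> W" using ab arcs_in_verts[OF ab(1)] by (auto simp: w_def)
  have finW: "finite W" using W(1) finite_verts finite_subset by auto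
  have abT: "(a, b) \<notin> T" using T ab by auto
  have "card (insert w W) = Suc m" using w W finW by simp
  moreover have "card (insert (a, b) T) = Suc m - 1"
    using abT T step.hyps finite_subset[OF T(1) finite_arcs] by simp
  moreover have "insert (a, b) T \<subseteq> insert w W \<times> insert w W" using T ab by (auto simp: w_def)
  moreover have "lifts_trivial_over (insert (a, b) T)"
    unfolding lifts_trivial_over_def
  proof (intro allI impI)
    fix n :: nat and \<pi> :: "'a \<times> 'a \<Rightarrow> nat \<Rightarrow> nat"
    assume \<pi>: "\<forall>e\<in>insert (a, b) T. \<pi> e permutes {1..n}"
    obtain s where s: "\<And>v. s v permutes {1..n}" "\<And>u v. (u, v) \<in> T \<Longrightarrow> \<pi> (u, v) \<circ> s u = s v"
      using lifts_trivial_overE[OF triv, of \<pi> n] \<pi> by blast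
    have p: "\<pi> (a, b) permutes {1..n}" using \<pi> by auto
    \<comment> \<open>The new vertex may be the head or the tail of the arc; the inverse handles the
      latter.\<close>
    define s' where "s' = s(w := if a \<in> W then \<pi> (a, b) \<circ> s a else inv (\<pi> (a, b)) \<circ> s b)"
    have "s' v permutes {1..n}" for v
      using s(1) p by (auto simp: s'_def intro: permutes_compose permutes_inv)
    moreover have "\<pi> (u, v) \<circ> s' u = s' v" if "(u, v) \<in> T" for u v
    proof -
      have "u \<noteq> w" "v \<noteq> w" using that T w by auto
      then show ?thesis using s(2)[OF that] by (simp add: s'_def)
    qed
    moreover have "\<pi> (a, b) \<circ> s' a = s' b"
      using ab w by (auto simp: s'_def w_def o_assoc permutes_inv_o[OF p])
    ultimately show "\<exists>s. (\<forall>v. s v permutes {1..n}) \<and> (\<forall>(u, v)\<in>insert (a, b) T. \<pi> (u, v) \<circ> s u = s v)"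
      by (intro exI[of _ s']) auto
  qed
  ultimately show ?case using W w T ab
    by (intro exI[of _ "insert w W"] exI[of _ "insert (a, b) T"]) auto
qed

text \<open>Fix the permutations on the tree \<open>T\<close> and randomise only the one on the
  remaining arc \<open>(a, b)\<close>. Carried around the cycle it acts on one fibre, and an orbit
  that is a proper subset of this fibre spreads to a closed family.\<close>

lemma prob_connected_unicyclic_le:
  assumes "0 < n" "card A = card (pverts G)"
  shows "measure_pmf.prob (random_lift G A n) {H. graph_connected H} \<le> 1 / real n"
proof -
  let ?S = "{1..n}"
  let ?U = "pmf_of_set {p. p permutes ?S}"
  have V: "card (pverts G) > 0" using finite_verts verts_nonempty by (simp add: card_gt_0_iff)
  obtain W T where W: "W \<subseteq> pverts G" "card W = card (pverts G)"
    and T: "T \<subseteq> A" "T \<subseteq> W \<times> W" "card T = card (pverts G) - 1"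
    and triv: "lifts_trivial_over T"
    using ex_trivialising_tree[of "card (pverts G)"] V by (auto simp: Suc_le_eq)
  have finT: "finite T" using T finite_arcs finite_subset by auto
  have "card (A - T) = 1" using T finT V assms(2) by (simp add: card_Diff_subset)
  then obtain a b where "A - T = {(a, b)}" by (auto simp: card_1_singleton_iff)
  then have A: "A = insert (a, b) T" "(a, b) \<notin> T" using T by auto
  have "measure_pmf.prob (random_lift G A n) {H. graph_connected H}
      = measure_pmf.prob (pair_pmf ?U (Pi_pmf T id (\<lambda>_. ?U)))
          {(p, f). graph_connected (lift_graph G A n (f((a, b) := p)))}"
    unfolding random_lift_def A(1) Pi_pmf_insert[OF finT A(2)]
    by (simp add: vimage_def case_prod_beta')
  also have "\<dots> \<le> 1 / real n"
  proof (rule prob_pair_pmf_le)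
    fix f assume "f \<in> set_pmf (Pi_pmf T id (\<lambda>_. ?U))"
    moreover have setU: "set_pmf ?U = {p. p permutes ?S}"
      using permutes_id[of ?S] by (intro set_pmf_of_set finite_permutations) blast+
    ultimately have f: "\<And>e. e \<in> T \<Longrightarrow> f e permutes ?S" "\<And>e. e \<notin> T \<Longrightarrow> f e = id"
      unfolding set_Pi_pmf[OF finT] PiE_dflt_def by auto
    then obtain s where s: "\<And>v. s v permutes ?S" "\<And>u v. (u, v) \<in> T \<Longrightarrow> f (u, v) \<circ> s u = s v"
      using lifts_trivial_overE[OF triv, of f n] by blast
    have cyc: "cyclic_on (inv (s b) \<circ> p \<circ> s a) ?S"
      if p: "p permutes ?S" and conn: "graph_connected (lift_graph G A n (f((a, b) := p)))" for p
    proof (rule ccontr)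
      let ?\<sigma> = "inv (s b) \<circ> p \<circ> s a"
      let ?\<pi> = "f((a, b) := p)"
      define O1 where "O1 = orbit ?\<sigma> 1"
      assume ncyc: "\<not> cyclic_on ?\<sigma> ?S"
      have \<sigma>: "?\<sigma> permutes ?S" using s p by (intro permutes_compose permutes_inv)
      have one: "1 \<in> ?S" using assms(1) by simp
      have sub: "O1 \<subseteq> ?S" unfolding O1_def by (rule permutes_orbit_subset[OF \<sigma> one])
      have cycO: "cyclic_on ?\<sigma> O1" unfolding O1_def by (rule cyclic_on_orbit[OF \<sigma>]) simp
      then have "O1 \<noteq> ?S" using ncyc by auto
      then have "card O1 < n" using sub psubset_card_mono[of ?S O1] by auto
      moreover have "O1 \<noteq> {}" using cycO by (auto simp: cyclic_on_def)
      then have "0 < card O1" using sub finite_subset[OF sub] by (simp add: card_gt_0_iff)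
      moreover have "e \<in> A \<Longrightarrow> ?\<pi> e permutes ?S" "e \<notin> A \<Longrightarrow> ?\<pi> e = id" for e
        using f(1)[of e] f(2)[of e] p A by auto
      then have "?\<pi> \<in> lifts n" unfolding lifts_def PiE_dflt_def by blast
      \<comment> \<open>Along arcs of \<open>T\<close> closedness is automatic from the choice of
        \<open>s\<close>; only \<open>(a, b)\<close> uses that \<open>O1\<close> is invariant under
        \<open>?\<sigma>\<close>.\<close>
      moreover have "(\<lambda>v\<in>pverts G. s v ` O1) \<in> closed_families n (card O1) ?\<pi>"
      proof (rule closed_familiesI)
        fix v assume "v \<in> pverts G"
        then show "(\<lambda>v\<in>pverts G. s v ` O1) v \<subseteq> ?S" "card ((\<lambda>v\<in>pverts G. s v ` O1) v) = card O1"
          using image_mono[OF sub, of "s v"] permutes_image[OF s(1)[of v]] card_image[OF permutes_inj_on[OF s(1)]]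
          by auto
      next
        fix u v assume uv: "(u, v) \<in> A"
        have "?\<pi> (u, v) ` s u ` O1 = s v ` O1"
        proof (cases "(u, v) = (a, b)")
          case True
          have "?\<sigma> ` O1 \<subseteq> O1" using cyclic_on_inI[OF cycO] by blast
          then have "?\<sigma> ` O1 = O1" using finite_subset[OF sub] permutes_inj_on[OF \<sigma>]
            by (intro endo_inj_surj) auto
          then have "s b ` ?\<sigma> ` O1 = s b ` O1" by simp
          moreover have "s b \<circ> ?\<sigma> = p \<circ> s a"
            by (simp add: o_assoc permutes_inv_o[OF s(1)])
          ultimately have "p ` s a ` O1 = s b ` O1" by (metis image_comp)
          then show ?thesis using True by simp
        next
          case False
          then have "(u, v) \<in> T" using uv A by auto
          then have "f (u, v) ` s u ` O1 = s v ` O1" using s(2) by (simp add: image_comp)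
          then show ?thesis using False by auto
        qed
        then show "?\<pi> (u, v) ` (\<lambda>v\<in>pverts G. s v ` O1) u = (\<lambda>v\<in>pverts G. s v ` O1) v"
          using arcs_in_verts[OF uv] by simp
      qed simp
      ultimately show False using closed_families_disconnect conn by blast
    qed
    have "measure_pmf.prob ?U {p. (p, f) \<in> {(p, f). graph_connected (lift_graph G A n (f((a, b) := p)))}}
        \<le> measure_pmf.prob ?U {p. cyclic_on (inv (s b) \<circ> p \<circ> s a) ?S}"
    proof (rule measure_pmf.finite_measure_mono_AE)
      show "AE p in ?U. p \<in> {p. (p, f) \<in> {(p, f). graph_connected (lift_graph G A n (f((a, b) := p)))}}
          \<longrightarrow> p \<in> {p. cyclic_on (inv (s b) \<circ> p \<circ> s a) ?S}"
      proof (rule AE_pmfI)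
        fix p assume "p \<in> set_pmf ?U"
        then have "p permutes ?S" unfolding setU by simp
        then show "p \<in> {p. (p, f) \<in> {(p, f). graph_connected (lift_graph G A n (f((a, b) := p)))}}
          \<longrightarrow> p \<in> {p. cyclic_on (inv (s b) \<circ> p \<circ> s a) ?S}" using cyc[of p] by simp
      qed
    qed simp
    also have "\<dots> \<le> 1 / card ?S"
      using assms(1) s(1) by (intro prob_cyclic_conjugate_le permutes_inv) auto
    finally show "measure_pmf.prob ?U {p. (p, f) \<in> {(p, f). graph_connected (lift_graph G A n (f((a, b) := p)))}}
        \<le> 1 / real n" by simp
  qed
  finally show ?thesis .
qed

end

section \<open>Explicit error bound and conclusion\<close>

lemma prob_random_lift_connected_approx:
  fixes G :: "'a pair_pre_digraph" and A :: "'a rel" and l :: nat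
  assumes "l \<ge> 1"
    and "pair_graph G"
    and "graph_connected G"
    and "int (card (uedges G)) - int (card (pverts G)) = int l - 1"
    and "orientation G A"
    and n: "2 \<le> n"
  shows "\<bar>measure_pmf.prob (random_lift G A n) {H. graph_connected H} - (1 - 1 / real n ^ (l - 1))\<bar>
    \<le> (4 ^ (l - 1) + 27 ^ (l - 1)) * (1 / real n ^ l)"
proof -
  have GA: "graph_lift G A" by (rule graph_lift.intro) fact+
  obtain m where l: "l = Suc m" using assms(1) by (cases l) auto
  have card: "card A = card (pverts G) + m"
    using card_orientation[OF assms(2,5)] assms(4) l by linarith
  let ?p = "\<lambda>n. measure_pmf.prob (random_lift G A n) {H. graph_connected H}"
  have "\<bar>?p n - (1 - 1 / real n ^ m)\<bar> \<le> (4 ^ m + 27 ^ m) * (1 / real n ^ l)"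
  proof (cases "m = 0")
    case True
    \<comment> \<open>Here the main term \<open>1 - 1 / n ^ 0\<close> vanishes and the constant is
      \<open>4 ^ 0 + 27 ^ 0 = 2\<close>, so an upper bound on the probability of connectivity
      suffices.\<close>
    then have "?p n \<le> 1 / real n" using graph_lift.prob_connected_unicyclic_le[OF GA, of n] card n by simp
    moreover have "1 / real n \<le> 2 / real n" by (simp add: divide_right_mono)
    ultimately show ?thesis using True l by simp
  next
    case False
    then have m: "1 \<le> m" by simp
    have "measure_pmf.prob (pmf_of_set (graph_lift.lifts A n))
        {\<pi>. \<not> graph_connected (lift_graph G A n \<pi>)} = 1 - ?p n"
      using graph_lift.prob_random_lift[OF GA, of n] by linarith
    note D = graph_lift.prob_disconnected_bounds[OF GA n card, unfolded this]
    have "1 / real n ^ m - 4 ^ m / real n ^ (m + 1) \<le> 1 - ?p n"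
      using D(2) inverse_choose_2_power_le[OF n m] by linarith
    moreover have "1 - ?p n \<le> 1 / real n ^ m + (4 ^ m + 27 ^ m) / real n ^ (m + 1)"
      using n by (intro order.trans[OF D(1)] sum_inverse_binomial_power_le[OF _ m]) simp
    \<comment> \<open>The lower bound loses only the \<open>4 ^ m\<close> term; adding the
      nonnegative \<open>27 ^ m\<close> term gives one constant for both sides.\<close>
    moreover have "0 \<le> 27 ^ m / real n ^ (m + 1)" by simp
    moreover have "(4 ^ m + 27 ^ m) * (1 / real n ^ l) = (4 ^ m + 27 ^ m) / real n ^ (m + 1)"
      by (simp add: l)
    ultimately show ?thesis unfolding add_divide_distrib by linarith
  qed
  then show ?thesis unfolding l by simp
qed

theorem theorem4p1:
  fixes G :: "'a pair_pre_digraph" and A :: "'a rel" and l :: nat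
  assumes "l \<ge> 1"
    and "pair_graph G"
    and "graph_connected G"
    and "int (card (uedges G)) - int (card (pverts G)) = int l - 1"
    and "orientation G A"
  shows "(\<lambda>n. measure_pmf.prob (random_lift G A n) {H. graph_connected H}
              - (1 - 1 / real n ^ (l - 1)))
         \<in> O(\<lambda>n. 1 / real n ^ l)"
proof (rule bigoI, rule eventually_at_top_linorderI)
  fix n :: nat assume "2 \<le> n"
  from prob_random_lift_connected_approx[OF assms this]
  show "norm (measure_pmf.prob (random_lift G A n) {H. graph_connected H} - (1 - 1 / real n ^ (l - 1)))
      \<le> (4 ^ (l - 1) + 27 ^ (l - 1)) * norm (1 / real n ^ l)" by simp
qed

end
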